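(* Let $T$ be a rooted tree (rooted at a vertex or at an edge) with leveled degree sequence $D$, and let $G(D)$ be the level greedy tree with leveled degree sequence $D$. Then $\mathrm{SO}(T)\ge\mathrm{SO}(G(D))$.
   Context: For a graph $G$, $\mathrm{SO}(G)=\sum_{uv\in E(G)}\sqrt{\deg_G(u)^2+\deg_G(v)^2}$. For a tree rooted at a vertex $r$, level $i$ is the set of vertices at distance $i-1$ from $r$; for a tree rooted at an edge $r_1r_2$, level $i$ is the set of vertices at distance $i-1$ from $\{r_1,r_2\}$ (level 1 is $\{r_1,r_2\}$). Children of $x$ are its neighbours at the next level. The leveled degree sequence is $D=(V_1,\dots,V_k)$ where $V_i=(i_{i,1}\ge i_{i,2}\ge\dots\ge i_{i,k_i})$ is the nonincreasing list of degrees at level $i$ and $k-1$ is the maximum level distance from the root. Level greedy tree $G(D)$: level 1 consists of $g^1_1,\dots,g^1_{k_1}$ ($k_1\in\{1,2\}$, joined by an edge if $k_1=2$) with $\deg g^1_j=i_{1,j}$. If level $h$ has vertices $g^h_1,\dots,g^h_{k_h}$ with $\deg g^h_j=i_{h,j}$, let $c_j$ be the number of children of $g^h_j$ (equal to $\deg g^h_j$ if $g^h_j$ is a vertex root, otherwise $\deg g^h_j-1$); the children of $g^h_1$ are $g^{h+1}_1,\dots,g^{h+1}_{c_1}$, those of $g^h_2$ are the next $c_2$ vertices, and so on, and $\deg g^{h+1}_j=i_{h+1,j}$. Thus vertices of larger degree receive children of larger degree. *)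

theory Defs
  imports Complex_Main "HOL-Library.Multiset"
begin

record 'a ugraph =
  verts :: "'a set"
  edges :: "'a set set"

definition simple_graph :: "'a ugraph \<Rightarrow> bool" where
  "simple_graph G \<longleftrightarrow> finite (verts G) \<and>
     edges G \<subseteq> {{u, v} | u v. u \<in> verts G \<and> v \<in> verts G \<and> u \<noteq> v}"

definition adj :: "'a ugraph \<Rightarrow> ('a \<times> 'a) set" where
  "adj G = {(u, v). {u, v} \<in> edges G}"

definition deg :: "'a ugraph \<Rightarrow> 'a \<Rightarrow> nat" where
  "deg G v = card {u. (v, u) \<in> adj G}"

definition sombor :: "'a ugraph \<Rightarrow> real" where
  "sombor G = (\<Sum>e\<in>edges G. sqrt (\<Sum>v\<in>e. (real (deg G v))\<^sup>2))"

definition connected_graph :: "'a ugraph \<Rightarrow> bool" where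
  "connected_graph G \<longleftrightarrow> verts G \<noteq> {} \<and> (\<forall>u\<in>verts G. \<forall>v\<in>verts G. (u, v) \<in> (adj G)\<^sup>*)"

text \<open>A cycle is given by the list of its (distinct) vertices in cyclic order.\<close>
definition is_cycle :: "'a ugraph \<Rightarrow> 'a list \<Rightarrow> bool" where
  "is_cycle G xs \<longleftrightarrow> length xs \<ge> 3 \<and> distinct xs \<and>
     successively (\<lambda>u v. (u, v) \<in> adj G) xs \<and> (last xs, hd xs) \<in> adj G"

definition tree :: "'a ugraph \<Rightarrow> bool" where
  "tree G \<longleftrightarrow> simple_graph G \<and> connected_graph G \<and> (\<nexists>xs. is_cycle G xs)"

text \<open>The root is the vertex set of either a single vertex or a single edge.\<close>
definition rooted_tree :: "'a ugraph \<Rightarrow> 'a set \<Rightarrow> bool" where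
  "rooted_tree T R \<longleftrightarrow> tree T \<and> ((\<exists>r\<in>verts T. R = {r}) \<or> R \<in> edges T)"

text \<open>Length of a shortest walk; meaningful only for vertices in the same component.\<close>
definition gdist :: "'a ugraph \<Rightarrow> 'a \<Rightarrow> 'a \<Rightarrow> nat" where
  "gdist G u v = (LEAST n. (u, v) \<in> adj G ^^ n)"

definition root_dist :: "'a ugraph \<Rightarrow> 'a set \<Rightarrow> 'a \<Rightarrow> nat" where
  "root_dist T R v = Min ((\<lambda>r. gdist T r v) ` R)"

text \<open>Levels are numbered from 1.\<close>
definition level :: "'a ugraph \<Rightarrow> 'a set \<Rightarrow> nat \<Rightarrow> 'a set" where
  "level T R i = {v \<in> verts T. Suc (root_dist T R v) = i}"

definition num_levels :: "'a ugraph \<Rightarrow> 'a set \<Rightarrow> nat" where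
  "num_levels T R = Suc (Max (root_dist T R ` verts T))"

text \<open>The list of the nonincreasing degree lists of levels \<open>1, \<dots>, k\<close>.\<close>
definition leveled_degree_sequence :: "'a ugraph \<Rightarrow> 'a set \<Rightarrow> nat list list" where
  "leveled_degree_sequence T R =
     map (\<lambda>i. rev (sorted_list_of_multiset (image_mset (deg T) (mset_set (level T R i)))))
       [1..<Suc (num_levels T R)]"

text \<open>
  The vertices of the level greedy tree are index pairs counted from 0: \<open>(h, j)\<close> stands for
  \<open>g\<close> with level \<open>h + 1\<close> and position \<open>j + 1\<close>, whose prescribed degree is \<open>D ! h ! j\<close>.
  The tree is rooted at a vertex if \<open>D ! 0\<close> has length 1 and at an edge if it has length 2.
\<close>
definition greedy_verts :: "nat list list \<Rightarrow> (nat \<times> nat) set" where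
  "greedy_verts D = {(h, j). h < length D \<and> j < length (D ! h)}"

definition num_children :: "nat list list \<Rightarrow> nat \<Rightarrow> nat \<Rightarrow> nat" where
  "num_children D h j =
     (if h = 0 \<and> length (D ! 0) = 1 then D ! h ! j else D ! h ! j - 1)"

text \<open>Consecutive blocks: the children of \<open>(h, j)\<close> come right after those of \<open>(h, 0), \<dots>, (h, j - 1)\<close>.\<close>
definition greedy_children :: "nat list list \<Rightarrow> nat \<Rightarrow> nat \<Rightarrow> nat set" where
  "greedy_children D h j =
     {(\<Sum>l<j. num_children D h l) ..< (\<Sum>l<j. num_children D h l) + num_children D h j}"

definition level_greedy_tree :: "nat list list \<Rightarrow> (nat \<times> nat) ugraph" where
  "level_greedy_tree D =
     \<lparr> verts = greedy_verts D,
       edges = (if length (D ! 0) = 2 then {{(0, 0), (0, 1)}} else {}) \<union>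
         {{(h, j), (Suc h, m)} | h j m.
            (h, j) \<in> greedy_verts D \<and> (Suc h, m) \<in> greedy_verts D \<and> m \<in> greedy_children D h j} \<rparr>"

end

theory Submission
  imports Defs
begin

text \<open>
  In \<open>T\<close> every non-root vertex has exactly one neighbour at the previous level, so \<open>SO(T)\<close> is the
  contribution of the root edge plus, level by level, the sum of \<open>s(deg (parent v), deg v)\<close> with
  \<open>s(x, y) = sqrt (x\<^sup>2 + y\<^sup>2)\<close>. The degree sequence fixes, for each level, both the multiset of
  the degrees \<open>deg v\<close> and the multiset of the parent degrees \<open>deg (parent v)\<close>, so only the way in
  which the two are paired depends on \<open>T\<close>. Since \<open>s\<close> is submodular, the sum is least when both are
  paired in nonincreasing order, and this is the pairing of the level greedy tree.
\<close>

section \<open>Rearrangement\<close>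

text \<open>Exchange argument: the heads \<open>x\<close> and \<open>y\<close> are the maxima of the
  two coordinates. If \<open>M\<close> pairs them elsewhere, as \<open>(x, d)\<close> and
  \<open>(b, y)\<close>, then replacing these pairs by \<open>(x, y)\<close> and
  \<open>(b, d)\<close> does not raise the sum, and \<open>(x, y)\<close> can be split off. Taking a
  multiset of pairs with given marginals as the pairing keeps this swap simple.\<close>

lemma rearrangement_submodular:
  fixes s :: "'a::linorder \<Rightarrow> 'b::linorder \<Rightarrow> real"
  assumes submod: "\<And>a b c d. b \<le> a \<Longrightarrow> d \<le> c \<Longrightarrow> s a c + s b d \<le> s a d + s b c"
    and "sorted_wrt (\<ge>) xs" "sorted_wrt (\<ge>) ys"
    and "image_mset fst M = mset xs" "image_mset snd M = mset ys"
  shows "(\<Sum>(x, y)\<leftarrow>zip xs ys. s x y) \<le> (\<Sum>(x, y)\<in>#M. s x y)"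
  using assms(2-)
proof (induction xs arbitrary: ys M)
  case Nil
  then show ?case by simp
next
  case (Cons x xs)
  have "size (mset ys) = size (mset (x # xs))"
    using Cons.prems(3,4) by (metis size_image_mset)
  then obtain y ys' where ys: "ys = y # ys'"
    by (cases ys) auto
  have "x \<in># image_mset fst M"
    using Cons.prems(3) by simp
  then obtain d where d: "(x, d) \<in># M"
    by force
  have "y \<in># image_mset snd M"
    using Cons.prems(4) ys by simp
  then obtain b where b: "(b, y) \<in># M"
    by force
  have sorted: "sorted_wrt (\<ge>) xs" "sorted_wrt (\<ge>) ys'"
    using Cons.prems(1,2) ys by auto
  show ?case
  proof (cases "b = x \<or> d = y")
    case True
    then have "(x, y) \<in># M"
      using b d by auto
    then obtain N where N: "M = add_mset (x, y) N"
      by (meson mset_add)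
    have "(\<Sum>(x, y)\<leftarrow>zip xs ys'. s x y) \<le> (\<Sum>(x, y)\<in>#N. s x y)"
      using Cons.prems(3,4) sorted by (intro Cons.IH) (auto simp: N ys)
    then show ?thesis
      by (simp add: N ys)
  next
    case False
    obtain N' where N': "M = add_mset (x, d) N'"
      using d by (meson mset_add)
    \<comment> \<open>Here \<open>b \<noteq> x\<close>, so removing \<open>(x, d)\<close> leaves
      \<open>(b, y)\<close> in place.\<close>
    then have "(b, y) \<in># N'"
      using b False by auto
    then obtain N where N: "N' = add_mset (b, y) N"
      by (meson mset_add)
    have fst: "add_mset b (image_mset fst N) = mset xs"
      and snd: "add_mset d (image_mset snd N) = mset ys'"
      using Cons.prems(3,4) by (auto simp: N N' ys add_mset_commute)
    then have "b \<in> set xs" "d \<in> set ys'"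
      by (metis union_single_eq_member set_mset_mset)+
    then have "b \<le> x" "d \<le> y"
      using Cons.prems(1,2) ys by auto
    then have "s x y + s b d \<le> s x d + s b y"
      by (rule submod)
    moreover have "(\<Sum>(x, y)\<leftarrow>zip xs ys'. s x y) \<le> (\<Sum>(x, y)\<in>#add_mset (b, d) N. s x y)"
      using fst snd sorted by (intro Cons.IH) auto
    ultimately show ?thesis
      by (simp add: N N' ys)
  qed
qed

text \<open>After squaring, both sides contain \<open>p + q + r + t\<close>, so only the products
  under the roots matter; they differ by \<open>(p - q) * (r - t)\<close>.\<close>

lemma sqrt_add_submodular:
  fixes p q r t :: real
  assumes "0 \<le> q" "q \<le> p" "0 \<le> t" "t \<le> r"
  shows "sqrt (p + r) + sqrt (q + t) \<le> sqrt (p + t) + sqrt (q + r)"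
proof (rule power2_le_imp_le)
  have "0 \<le> (p - q) * (r - t)"
    using assms by simp
  then have "(p + r) * (q + t) \<le> (p + t) * (q + r)"
    by (simp add: algebra_simps)
  then have "sqrt (p + r) * sqrt (q + t) \<le> sqrt (p + t) * sqrt (q + r)"
    by (metis real_sqrt_le_iff real_sqrt_mult)
  then show "(sqrt (p + r) + sqrt (q + t))\<^sup>2 \<le> (sqrt (p + t) + sqrt (q + r))\<^sup>2"
    using assms by (simp add: power2_sum)
qed (use assms in simp)

section \<open>Consecutive blocks\<close>

text \<open>This makes the parent of a vertex of the greedy tree unique; \<open>block_exists\<close>
  provides its existence.\<close>

lemma block_disjoint:
  fixes c :: "nat \<Rightarrow> nat"
  assumes "m \<in> {sum c {..<i}..<sum c {..<i} + c i}"
    and "m \<in> {sum c {..<j}..<sum c {..<j} + c j}"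
  shows "i = j"
proof -
  have "\<not> a < b" if "m < sum c {..<a} + c a" "sum c {..<b} \<le> m" for a b
  proof
    assume "a < b"
    then have "sum c {..<Suc a} \<le> sum c {..<b}"
      by (intro sum_mono2) auto
    then show False
      using that by simp
  qed
  from this[of i j] this[of j i] show ?thesis
    using assms by (auto simp: not_less)
qed

lemma block_exists:
  fixes c :: "nat \<Rightarrow> nat"
  assumes "m < sum c {..<n}"
  shows "\<exists>j<n. m \<in> {sum c {..<j}..<sum c {..<j} + c j}"
  using assms
proof (induction n)
  case (Suc n)
  then show ?case
    by (cases "m < sum c {..<n}") (auto intro: less_SucI)
qed simp

lemma length_concat_replicate:
  "length (concat (map (\<lambda>j. replicate (c j) (x j)) [0..<n])) = sum c {..<n}"
  by (induction n) auto

text \<open>With \<open>c j\<close> the number of children and \<open>x j\<close> the degree of the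
  \<open>j\<close>-th vertex, the list gives at each position of the next level the degree of the
  parent.\<close>

lemma nth_concat_replicate:
  assumes "j < n" "m \<in> {sum c {..<j}..<sum c {..<j} + c j}"
  shows "concat (map (\<lambda>j. replicate (c j) (x j)) [0..<n]) ! m = x j"
  using assms
proof (induction n)
  case (Suc n)
  show ?case
  proof (cases "j = n")
    case True
    then show ?thesis
      using Suc.prems by (auto simp: nth_append length_concat_replicate)
  next
    case False
    then have "j < n"
      using Suc.prems by simp
    moreover from this have "sum c {..<Suc j} \<le> sum c {..<n}"
      by (intro sum_mono2) auto
    then have "m < sum c {..<n}"
      using Suc.prems by simp
    ultimately show ?thesis
      using Suc by (simp add: nth_append length_concat_replicate)
  qed
qed simp

lemma sorted_wrt_concat_replicate:
  assumes "\<And>i j. i \<le> j \<Longrightarrow> j < n \<Longrightarrow> x j \<le> (x i :: 'a::linorder)"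
  shows "sorted_wrt (\<ge>) (concat (map (\<lambda>j. replicate (c j) (x j)) [0..<n]))"
proof -
  have "sorted_wrt (\<ge>) (replicate k a)" for k and a :: 'a
    by (induction k) auto
  then show ?thesis
    using assms by (induction n) (auto simp: sorted_wrt_append)
qed

lemma sum_single_mset: "finite A \<Longrightarrow> (\<Sum>v\<in>A. {#a#}) = replicate_mset (card A) a"
  by (induction A rule: finite_induct) auto

text \<open>The multiplicity depends on the entry only and not on its position, so the order of
  \<open>xs\<close> can be forgotten.\<close>

lemma mset_concat_replicate_nth:
  "mset (concat (map (\<lambda>j. replicate (f (xs ! j)) (xs ! j)) [0..<length xs])) =
     (\<Sum>x\<in>#mset xs. replicate_mset (f x) x)"
proof -
  have "map (\<lambda>j. replicate (f (xs ! j)) (xs ! j)) [0..<length xs] =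
      map (\<lambda>x. replicate (f x) x) (map ((!) xs) [0..<length xs])"
    by (simp add: comp_def)
  also have "map ((!) xs) [0..<length xs] = xs"
    by (rule map_nth)
  finally show ?thesis
    by (simp add: mset_concat comp_def flip: sum_mset_sum_list)
qed

lemma sum_singleton_Times: "(\<Sum>v\<in>{a} \<times> B. f v) = (\<Sum>b\<in>B. f (a, b))"
proof -
  have "{a} \<times> B = Pair a ` B"
    by auto
  then show ?thesis
    by (simp add: sum.reindex inj_on_def)
qed

section \<open>Leveled graphs\<close>

definition layer :: "'a ugraph \<Rightarrow> ('a \<Rightarrow> nat) \<Rightarrow> nat \<Rightarrow> 'a set" where
  "layer G lev h = {v \<in> verts G. lev v = h}"

text \<open>Common abstraction of \<open>T\<close> and of the level greedy tree: a level function
  counted from 0 and a parent function describe all edges, so degrees and the Sombor index are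
  computed once for both.\<close>

locale leveled_graph =
  fixes G :: "'a ugraph" and lev :: "'a \<Rightarrow> nat" and par :: "'a \<Rightarrow> 'a"
  assumes finite_verts: "finite (verts G)"
    and card_roots: "card (layer G lev 0) \<in> {1, 2}"
    and edges_eq: "edges G = (if card (layer G lev 0) = 2 then {layer G lev 0} else {}) \<union>
      (\<lambda>v. {par v, v}) ` {v \<in> verts G. 0 < lev v}"
    and par_verts: "v \<in> verts G \<Longrightarrow> 0 < lev v \<Longrightarrow> par v \<in> verts G"
    and lev_par: "v \<in> verts G \<Longrightarrow> 0 < lev v \<Longrightarrow> lev v = Suc (lev (par v))"
begin

abbreviation L :: "nat \<Rightarrow> 'a set" where
  "L \<equiv> layer G lev"

definition children :: "'a \<Rightarrow> 'a set" where
  "children v = {u \<in> L (Suc (lev v)). par u = v}"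

lemma finite_layer: "finite (L h)"
  using finite_verts by (simp add: layer_def)

lemma finite_children: "finite (children v)"
  using finite_layer by (simp add: children_def)

lemma neighbours:
  assumes v: "v \<in> verts G"
  shows "{u. (v, u) \<in> adj G} = children v \<union> (if lev v = 0 then L 0 - {v} else {par v})"
    (is "?N = ?C \<union> ?P")
proof (intro equalityI subsetI)
  fix u assume "u \<in> ?N"
  then have "{v, u} \<in> edges G"
    by (simp add: adj_def)
  then consider "card (L 0) = 2" "{v, u} = L 0"
    | w where "w \<in> verts G" "0 < lev w" "{v, u} = {par w, w}"
    unfolding edges_eq by (auto split: if_splits)
  then show "u \<in> ?C \<union> ?P"
  proof cases
    case 1
    then have "card {v, u} = 2"
      by simp
    then have "u \<noteq> v"
      by auto
    moreover have "v \<in> L 0" "u \<in> L 0"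
      using 1 by blast+
    ultimately have "u \<noteq> v" "lev v = 0" "u \<in> L 0"
      by (auto simp: layer_def)
    then show ?thesis by simp
  next
    case 2
    then have "v = par w \<and> u = w \<or> v = w \<and> u = par w"
      by (auto simp: doubleton_eq_iff)
    then show ?thesis
      using 2 lev_par[of w] by (auto simp: children_def layer_def)
  qed
next
  fix u assume u: "u \<in> ?C \<union> ?P"
  consider "u \<in> ?C" | "lev v = 0" "u \<in> L 0" "u \<noteq> v" | "lev v \<noteq> 0" "u = par v"
    using u by (auto split: if_splits)
  then have "{v, u} \<in> edges G"
  proof cases
    case 1
    then show ?thesis
      unfolding edges_eq by (auto simp: children_def layer_def)
  next
    case 2
    \<comment> \<open>Level 0 has at most two vertices, so two distinct ones exhaust it and form the
      root edge.\<close>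
    have sub: "{v, u} \<subseteq> L 0" "card {v, u} = 2"
      using v 2 by (auto simp: layer_def)
    then have "card (L 0) = 2"
      using card_roots card_mono[OF finite_layer sub(1)] by auto
    moreover from this have "{v, u} = L 0"
      using sub by (intro card_subset_eq finite_layer) auto
    ultimately show ?thesis
      unfolding edges_eq by simp
  next
    case 3
    then show ?thesis
      unfolding edges_eq using v by (auto simp: insert_commute)
  qed
  then show "u \<in> ?N"
    by (simp add: adj_def)
qed

text \<open>The neighbours that are not children are the parent or, at level 0, the other root; the
  truncated \<open>card (L 0) - 1\<close> is 0 for a vertex root.\<close>

lemma deg_eq:
  assumes v: "v \<in> verts G"
  shows "deg G v = card (children v) + (if lev v = 0 then card (L 0) - 1 else 1)"
proof -
  have "children v \<inter> (if lev v = 0 then L 0 - {v} else {par v}) = {}"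
    using lev_par[OF v] by (auto simp: children_def layer_def)
  moreover have "v \<in> L 0" if "lev v = 0"
    using v that by (simp add: layer_def)
  ultimately show ?thesis
    unfolding deg_def neighbours[OF v]
    by (subst card_Un_disjoint) (auto simp: finite_children finite_layer)
qed

lemma card_children:
  assumes "v \<in> verts G"
  shows "card (children v) = (if lev v = 0 \<and> card (L 0) = 1 then deg G v else deg G v - 1)"
  using deg_eq[OF assms] card_roots by auto

text \<open>Grouping level \<open>Suc h\<close> by parents counts each degree at level
  \<open>h\<close> once per child. By \<open>card_children\<close> the result depends only on the
  degrees at level \<open>h\<close> and the type of root.\<close>

lemma parent_degrees:
  "image_mset (\<lambda>v. deg G (par v)) (mset_set (L (Suc h))) =
     (\<Sum>v\<in>L h. replicate_mset (card (children v)) (deg G v))"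
proof -
  have "image_mset (\<lambda>v. deg G (par v)) (mset_set (L (Suc h))) =
      (\<Sum>v\<in>L (Suc h). {#deg G (par v)#})"
    by (simp add: sum_unfold_sum_mset)
  also have "\<dots> = (\<Sum>u\<in>L h. \<Sum>v\<in>{v \<in> L (Suc h). par v = u}. {#deg G (par v)#})"
    using par_verts lev_par
    by (intro sum.group[symmetric] finite_layer) (force simp: layer_def)
  also have "\<dots> = (\<Sum>u\<in>L h. \<Sum>v\<in>children u. {#deg G u#})"
    by (intro sum.cong) (auto simp: children_def layer_def)
  also have "\<dots> = (\<Sum>v\<in>L h. replicate_mset (card (children v)) (deg G v))"
    by (simp add: sum_single_mset finite_children)
  finally show ?thesis .
qed

text \<open>Each edge other than the root edge is named by its end farther from the root,
  injectively because the levels of its ends differ; the sum over these ends is then split by the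
  level \<open>h\<close> of the parent.\<close>

lemma sombor_eq:
  assumes "\<And>v. v \<in> verts G \<Longrightarrow> lev v \<le> K"
  shows "sombor G =
    (if card (L 0) = 2 then sqrt (\<Sum>v\<in>L 0. (real (deg G v))\<^sup>2) else 0) +
    (\<Sum>h<K. \<Sum>v\<in>L (Suc h). sqrt ((real (deg G (par v)))\<^sup>2 + (real (deg G v))\<^sup>2))"
proof -
  define w where "w e = sqrt (\<Sum>v\<in>e. (real (deg G v))\<^sup>2)" for e
  let ?N = "{v \<in> verts G. 0 < lev v}" and ?R = "if card (L 0) = 2 then {L 0} else {}"
  have inj: "inj_on (\<lambda>v. {par v, v}) ?N"
  proof (rule inj_onI)
    fix u v assume "u \<in> ?N" "v \<in> ?N" "{par u, u} = {par v, v}"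
    then show "u = v"
      using lev_par[of u] lev_par[of v] by (auto simp: doubleton_eq_iff)
  qed
  have disj: "{par v, v} \<noteq> L 0" if "v \<in> ?N" for v
  proof -
    have "v \<notin> L 0"
      using that by (simp add: layer_def)
    then show ?thesis by blast
  qed
  have "sombor G = sum w (?R \<union> (\<lambda>v. {par v, v}) ` ?N)"
    unfolding sombor_def w_def edges_eq ..
  also have "\<dots> = sum w ?R + sum w ((\<lambda>v. {par v, v}) ` ?N)"
    using disj by (intro sum.union_disjoint) (auto simp: finite_verts)
  also have "sum w ((\<lambda>v. {par v, v}) ` ?N) = (\<Sum>v\<in>?N. w {par v, v})"
    by (simp add: sum.reindex[OF inj] comp_def)
  also have "\<dots> = (\<Sum>h<K. \<Sum>v\<in>{v \<in> ?N. lev v - 1 = h}. w {par v, v})"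
    using assms by (intro sum.group[symmetric]) (force simp: finite_verts)+
  also have "\<dots> = (\<Sum>h<K. \<Sum>v\<in>L (Suc h). sqrt ((real (deg G (par v)))\<^sup>2 + (real (deg G v))\<^sup>2))"
  proof (intro sum.cong refl)
    fix h show "{v \<in> ?N. lev v - 1 = h} = L (Suc h)"
      by (auto simp: layer_def)
  next
    fix h v assume "v \<in> L (Suc h)"
    then have "lev v = Suc (lev (par v))"
      by (intro lev_par) (auto simp: layer_def)
    then have "par v \<noteq> v"
      by auto
    then show "w {par v, v} = sqrt ((real (deg G (par v)))\<^sup>2 + (real (deg G v))\<^sup>2)"
      by (simp add: w_def)
  qed
  finally show ?thesis
    by (simp add: w_def)
qed

end

section \<open>Leveled graphs with a given leveled degree sequence\<close>

locale degree_leveled_graph = leveled_graph +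
  fixes D :: "nat list list" and K :: nat
  assumes length_D: "length D = Suc K"
    and mset_D: "h \<le> K \<Longrightarrow> mset (D ! h) = image_mset (deg G) (mset_set (layer G lev h))"
    and sorted_D: "h \<le> K \<Longrightarrow> sorted_wrt (\<ge>) (D ! h)"
    and lev_le: "v \<in> verts G \<Longrightarrow> lev v \<le> K"
begin

lemma length_nth_D: "h \<le> K \<Longrightarrow> length (D ! h) = card (L h)"
  using mset_D[of h] by (metis size_image_mset size_mset size_mset_set)

text \<open>Entry \<open>m\<close> is the degree that the parent of the vertex
  \<open>(Suc h, m)\<close> has in the greedy tree.\<close>

definition parent_list :: "nat \<Rightarrow> nat list" where
  "parent_list h = concat (map (\<lambda>j. replicate (num_children D h j) (D ! h ! j)) [0..<length (D ! h)])"

lemma mset_parent_list: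
  assumes "h \<le> K"
  shows "mset (parent_list h) = image_mset (\<lambda>v. deg G (par v)) (mset_set (L (Suc h)))"
proof -
  \<comment> \<open>At a fixed level the number of children is a function of the degree alone, by
    the same rule in \<open>G\<close> and in the greedy tree.\<close>
  define f where "f d = (if h = 0 \<and> length (D ! 0) = 1 then d else d - 1)" for d :: nat
  have "mset (parent_list h) = (\<Sum>d\<in>#mset (D ! h). replicate_mset (f d) d)"
    unfolding parent_list_def mset_concat_replicate_nth[symmetric]
    by (simp add: num_children_def f_def)
  also have "\<dots> = (\<Sum>v\<in>L h. replicate_mset (f (deg G v)) (deg G v))"
    by (simp add: mset_D assms image_mset.compositionality comp_def sum_unfold_sum_mset)
  also have "\<dots> = (\<Sum>v\<in>L h. replicate_mset (card (children v)) (deg G v))"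
    using card_children by (intro sum.cong refl) (auto simp: layer_def f_def length_nth_D)
  finally show ?thesis
    by (simp add: parent_degrees)
qed

text \<open>Comparing sizes in \<open>mset_parent_list\<close> shows that the blocks of level
  \<open>h\<close> fill the next level exactly.\<close>

lemma sum_num_children:
  assumes "h \<le> K"
  shows "sum (num_children D h) {..<length (D ! h)} = card (L (Suc h))"
  using arg_cong[OF mset_parent_list[OF assms], of size]
  by (simp add: parent_list_def length_concat_replicate)

lemma sorted_parent_list:
  assumes "h \<le> K"
  shows "sorted_wrt (\<ge>) (parent_list h)"
  unfolding parent_list_def
proof (rule sorted_wrt_concat_replicate)
  fix i j assume "i \<le> j" "j < length (D ! h)"
  then show "D ! h ! j \<le> D ! h ! i"
    using sorted_D[OF assms] by (cases "i = j") (auto simp: sorted_wrt_iff_nth_less)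
qed

text \<open>Apart from a vertex root, every vertex is adjacent to its parent or to the other root.
  Hence the subtraction in \<open>num_children\<close> does not truncate.\<close>

lemma nth_D_pos:
  assumes "h \<le> K" "j < length (D ! h)" "\<not> (h = 0 \<and> length (D ! 0) = 1)"
  shows "0 < D ! h ! j"
proof -
  have "D ! h ! j \<in># mset (D ! h)"
    using assms(2) by simp
  then obtain v where "v \<in> L h" "D ! h ! j = deg G v"
    by (auto simp: mset_D assms(1) finite_layer)
  then show ?thesis
    using deg_eq[of v] assms card_roots length_nth_D[of 0] by (auto simp: layer_def)
qed

lemma no_children_last:
  assumes "j < length (D ! K)"
  shows "num_children D K j = 0"
proof -
  have "L (Suc K) = {}"
    using lev_le by (force simp: layer_def)
  then show ?thesis
    using sum_num_children[of K] assms by simp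
qed

section \<open>The level greedy tree as a leveled graph\<close>

definition gpar :: "nat \<times> nat \<Rightarrow> nat \<times> nat" where
  "gpar = (\<lambda>(h, m). (h - 1, SOME j. m \<in> greedy_children D (h - 1) j))"

text \<open>Blocks are disjoint, so the choice in \<open>gpar\<close> is forced.\<close>

lemma gpar_eq:
  assumes "m \<in> greedy_children D h j"
  shows "gpar (Suc h, m) = (h, j)"
proof -
  have "(SOME i. m \<in> greedy_children D h i) = j"
    using assms block_disjoint unfolding greedy_children_def by (blast intro: some_equality)
  then show ?thesis
    by (simp add: gpar_def)
qed

lemma greedy_parent_exists:
  assumes "(Suc h, m) \<in> greedy_verts D"
  shows "\<exists>j<length (D ! h). m \<in> greedy_children D h j"
  using assms sum_num_children[of h] length_nth_D[of "Suc h"]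
  unfolding greedy_children_def by (intro block_exists) (auto simp: greedy_verts_def length_D)

text \<open>No block overruns the next level, so restricting the edges to
  \<open>greedy_verts\<close> loses no child.\<close>

lemma greedy_children_bound:
  assumes "h < K" "j < length (D ! h)" "m \<in> greedy_children D h j"
  shows "m < length (D ! Suc h)"
proof -
  have "sum (num_children D h) {..<Suc j} \<le> sum (num_children D h) {..<length (D ! h)}"
    using assms(2) by (intro sum_mono2) auto
  then show ?thesis
    using assms sum_num_children[of h] length_nth_D[of "Suc h"] by (auto simp: greedy_children_def)
qed

abbreviation H :: "(nat \<times> nat) ugraph" where
  "H \<equiv> level_greedy_tree D"

lemma verts_H: "verts H = greedy_verts D"
  by (simp add: level_greedy_tree_def)

lemma layer_H:
  assumes "h \<le> K"
  shows "layer H fst h = {h} \<times> {..<length (D ! h)}"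
  using assms by (auto simp: layer_def verts_H greedy_verts_def length_D)

lemma leveled_graph_H: "leveled_graph H fst gpar"
proof
  have "greedy_verts D = (SIGMA h:{..<length D}. {..<length (D ! h)})"
    by (auto simp: greedy_verts_def)
  then show "finite (verts H)"
    by (simp add: verts_H)
  show "card (layer H fst 0) \<in> {1, 2}"
    using card_roots by (simp add: layer_H length_nth_D card_cartesian_product)
  have "{0} \<times> {..<2::nat} = {(0 :: nat, 0), (0, 1)}"
    by auto
  then have roots: "(if length (D ! 0) = 2 then {{(0, 0), (0, 1)}} else {}) =
      (if card (layer H fst 0) = 2 then {layer H fst 0} else {})"
    by (simp add: layer_H card_cartesian_product)
  \<comment> \<open>The edges between levels are reindexed by the child alone.\<close>
  have "{{(h, j), (Suc h, m)} | h j m. (h, j) \<in> greedy_verts D \<and> (Suc h, m) \<in> greedy_verts D \<and>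
        m \<in> greedy_children D h j} = (\<lambda>v. {gpar v, v}) ` {v \<in> greedy_verts D. 0 < fst v}"
    (is "?E = ?F")
  proof (intro equalityI subsetI)
    fix e assume "e \<in> ?E"
    then obtain h j m where e: "e = {(h, j), (Suc h, m)}" "(Suc h, m) \<in> greedy_verts D"
      and m: "m \<in> greedy_children D h j"
      by blast
    have "e = {gpar (Suc h, m), (Suc h, m)}"
      using e(1) gpar_eq[OF m] by simp
    moreover have "(Suc h, m) \<in> {v \<in> greedy_verts D. 0 < fst v}"
      using e(2) by simp
    ultimately show "e \<in> ?F"
      by (rule image_eqI)
  next
    fix e assume "e \<in> ?F"
    then obtain v where v': "e = {gpar v, v}" "v \<in> greedy_verts D" "0 < fst v"
      by blast
    obtain h m where "v = (Suc h, m)"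
      using v'(3) by (metis gr0_conv_Suc prod.collapse)
    then have e: "e = {gpar (Suc h, m), (Suc h, m)}" and v: "(Suc h, m) \<in> greedy_verts D"
      using v' by auto
    obtain j where "j < length (D ! h)" "m \<in> greedy_children D h j"
      using greedy_parent_exists[OF v] by blast
    moreover from this have "(h, j) \<in> greedy_verts D"
      using v by (simp add: greedy_verts_def)
    ultimately show "e \<in> ?E"
      using e v gpar_eq[of m h j] by auto
  qed
  then show "edges H = (if card (layer H fst 0) = 2 then {layer H fst 0} else {}) \<union>
      (\<lambda>v. {gpar v, v}) ` {v \<in> verts H. 0 < fst v}"
    unfolding verts_H roots[symmetric] by (simp add: level_greedy_tree_def)
next
  fix v assume v: "v \<in> verts H" "0 < fst v"
  obtain h m where "v = (Suc h, m)"
    using v(2) by (metis gr0_conv_Suc prod.collapse)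
  then have hm: "v = (Suc h, m)" "(Suc h, m) \<in> greedy_verts D"
    using v(1) by (simp_all add: verts_H)
  then obtain j where "j < length (D ! h)" "m \<in> greedy_children D h j"
    using greedy_parent_exists by blast
  then show "gpar v \<in> verts H" "fst v = Suc (fst (gpar v))"
    using hm gpar_eq by (auto simp: verts_H greedy_verts_def)
qed

sublocale H: leveled_graph H fst gpar
  by (rule leveled_graph_H)

lemma children_H:
  assumes "h \<le> K" "j < length (D ! h)"
  shows "card (H.children (h, j)) = num_children D h j"
proof (cases "h = K")
  case True
  have "H.children (h, j) = {}"
    by (auto simp: H.children_def layer_def verts_H greedy_verts_def length_D True)
  then show ?thesis
    using no_children_last assms True by simp
next
  case False
  then have "h < K"
    using assms by simp
  have "H.children (h, j) = {Suc h} \<times> greedy_children D h j" (is "?C = ?S")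
  proof (intro equalityI subsetI)
    fix v assume "v \<in> ?C"
    then obtain m where m: "v = (Suc h, m)" "(Suc h, m) \<in> greedy_verts D" "gpar v = (h, j)"
      by (cases v) (auto simp: H.children_def layer_def verts_H)
    then show "v \<in> ?S"
      using greedy_parent_exists[OF m(2)] gpar_eq by auto
  next
    fix v assume "v \<in> ?S"
    then show "v \<in> ?C"
      using greedy_children_bound[OF \<open>h < K\<close> assms(2)] gpar_eq \<open>h < K\<close>
      by (auto simp: H.children_def layer_H)
  qed
  then show ?thesis
    by (simp add: card_cartesian_product greedy_children_def)
qed

text \<open>The greedy tree realises the prescribed degrees: \<open>deg_eq\<close> adds back the
  parent or second root that \<open>num_children\<close> subtracts.\<close>

lemma deg_H:
  assumes "h \<le> K" "j < length (D ! h)"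
  shows "deg H (h, j) = D ! h ! j"
proof -
  have "(h, j) \<in> verts H"
    using assms by (simp add: verts_H greedy_verts_def length_D)
  then have "deg H (h, j) = num_children D h j + (if h = 0 then length (D ! 0) - 1 else 1)"
    by (simp add: H.deg_eq children_H assms layer_H card_cartesian_product)
  moreover have "length (D ! 0) \<in> {1, 2}"
    using card_roots by (simp add: length_nth_D)
  ultimately show ?thesis
    using nth_D_pos[OF assms] by (auto simp: num_children_def)
qed

text \<open>The two instances of \<open>sombor_eq\<close> are compared term by term: the root terms
  agree, and each level is handled by rearrangement.\<close>

theorem sombor_greedy_le: "sombor (level_greedy_tree D) \<le> sombor G"
proof -
  define s :: "nat \<Rightarrow> nat \<Rightarrow> real" where "s x y = sqrt ((real x)\<^sup>2 + (real y)\<^sup>2)" for x y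
  have submod: "s a c + s b d \<le> s a d + s b c" if "b \<le> a" "d \<le> c" for a b c d
    unfolding s_def using that by (intro sqrt_add_submodular) (auto intro: power_mono)
  have card_eq: "card (layer H fst 0) = card (L 0)"
    by (simp add: layer_H length_nth_D card_cartesian_product)
  have "(\<Sum>v\<in>layer H fst 0. (real (deg H v))\<^sup>2) = (\<Sum>j<length (D ! 0). (real (D ! 0 ! j))\<^sup>2)"
    by (simp add: layer_H deg_H sum_singleton_Times)
  also have "\<dots> = (\<Sum>d\<leftarrow>D ! 0. (real d)\<^sup>2)"
    by (simp add: sum_list_sum_nth atLeast0LessThan)
  also have "\<dots> = (\<Sum>d\<in>#mset (D ! 0). (real d)\<^sup>2)"
    by (metis mset_map sum_mset_sum_list)
  also have "\<dots> = (\<Sum>v\<in>L 0. (real (deg G v))\<^sup>2)"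
    by (simp add: mset_D image_mset.compositionality comp_def sum_unfold_sum_mset)
  finally have roots: "(\<Sum>v\<in>layer H fst 0. (real (deg H v))\<^sup>2) = (\<Sum>v\<in>L 0. (real (deg G v))\<^sup>2)" .
  have levels: "(\<Sum>v\<in>layer H fst (Suc h). s (deg H (gpar v)) (deg H v)) \<le>
      (\<Sum>v\<in>L (Suc h). s (deg G (par v)) (deg G v))" if h: "h < K" for h
  proof -
    \<comment> \<open>The pairing realised by \<open>G\<close>; its marginals are the multisets of
      \<open>parent_list h\<close> and \<open>D ! Suc h\<close>, which the greedy tree pairs in
      sorted order.\<close>
    let ?M = "image_mset (\<lambda>v. (deg G (par v), deg G v)) (mset_set (L (Suc h)))"
    have len: "length (parent_list h) = length (D ! Suc h)"
      using sum_num_children[of h] length_nth_D[of "Suc h"] h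
      by (simp add: parent_list_def length_concat_replicate)
    have deg_gpar: "deg H (gpar (Suc h, m)) = parent_list h ! m" if m: "m < length (D ! Suc h)" for m
    proof -
      have "(Suc h, m) \<in> greedy_verts D"
        using h m by (simp add: greedy_verts_def length_D)
      then obtain j where j: "j < length (D ! h)" "m \<in> greedy_children D h j"
        using greedy_parent_exists by blast
      then show ?thesis
        using h by (simp add: gpar_eq deg_H parent_list_def greedy_children_def nth_concat_replicate)
    qed
    have "(\<Sum>v\<in>layer H fst (Suc h). s (deg H (gpar v)) (deg H v)) =
        (\<Sum>m<length (D ! Suc h). s (parent_list h ! m) (D ! Suc h ! m))"
      using h by (simp add: layer_H deg_H deg_gpar sum_singleton_Times)
    also have "\<dots> = (\<Sum>(x, y)\<leftarrow>zip (parent_list h) (D ! Suc h). s x y)"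
      by (simp add: sum_list_sum_nth atLeast0LessThan len)
    also have "\<dots> \<le> (\<Sum>(x, y)\<in>#?M. s x y)"
      using submod sorted_parent_list[of h] sorted_D[of "Suc h"] mset_parent_list[of h]
        mset_D[of "Suc h"] h
      by (intro rearrangement_submodular) (simp_all add: image_mset.compositionality comp_def)
    also have "\<dots> = (\<Sum>v\<in>L (Suc h). s (deg G (par v)) (deg G v))"
      by (simp add: image_mset.compositionality comp_def sum_unfold_sum_mset)
    finally show ?thesis .
  qed
  have le: "fst v \<le> K" if "v \<in> verts H" for v
    using that by (auto simp: verts_H greedy_verts_def length_D)
  show ?thesis
    unfolding sombor_eq[OF lev_le, simplified] H.sombor_eq[OF le, simplified] roots card_eq
    using levels by (auto simp: s_def intro!: sum_mono add_left_mono)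
qed

end

section \<open>Levels of a rooted tree\<close>

text \<open>A shortest walk from \<open>u\<close> to \<open>v\<close> avoiding their edge repeats no
  vertex, and that edge closes it to a cycle.\<close>

lemma cycle_through_edge:
  assumes "simple_graph G" "{u, v} \<in> edges G" "(u, v) \<in> (adj G - {(u, v), (v, u)})\<^sup>*"
  shows "\<exists>xs. is_cycle G xs"
proof -
  let ?S = "adj G - {(u, v), (v, u)}"
  define n where "n = (LEAST n. (u, v) \<in> ?S ^^ n)"
  have n: "(u, v) \<in> ?S ^^ n"
    unfolding n_def using assms(3) by (metis LeastI rtrancl_imp_relpow)
  have least: "n \<le> k" if "(u, v) \<in> ?S ^^ k" for k
    unfolding n_def using that by (rule Least_le)
  obtain f where f: "f 0 = u" "f n = v" "\<And>i. i < n \<Longrightarrow> (f i, f (Suc i)) \<in> ?S"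
    using n by (auto simp: relpow_fun_conv)
  have walk: "(f i, f (i + k)) \<in> ?S ^^ k" if "i + k \<le> n" for i k
    unfolding relpow_fun_conv using f(3) that by (intro exI[of _ "\<lambda>l. f (i + l)"]) auto
  have neq: "f i \<noteq> f j" if "i < j" "j \<le> n" for i j
  proof
    assume "f i = f j"
    moreover have "(u, f i) \<in> ?S ^^ i" "(f j, v) \<in> ?S ^^ (n - j)"
      using walk[of 0 i] walk[of j "n - j"] that f(1,2) by auto
    \<comment> \<open>Cutting out the part between positions \<open>i\<close> and \<open>j\<close>
      would give a shorter walk.\<close>
    ultimately have "(u, v) \<in> ?S ^^ (i + (n - j))"
      by (auto simp: relpow_add)
    then show False
      using least that by fastforce
  qed
  \<comment> \<open>Length 0 would force \<open>u = v\<close>, and length 1 would use the removed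
    edge; so the walk has at least three vertices, as a cycle requires.\<close>
  have "u \<noteq> v"
    using assms(1,2) by (auto simp: simple_graph_def doubleton_eq_iff)
  have "n \<noteq> 0"
    using f(1,2) \<open>u \<noteq> v\<close> by metis
  moreover have "n \<noteq> 1"
    using f(1,2) f(3)[of 0] by auto
  ultimately have "2 \<le> n"
    by simp
  have "inj_on f {0..<Suc n}"
    using neq by (intro linorder_inj_onI) auto
  then have "distinct (map f [0..<Suc n])"
    by (simp add: distinct_map del: upt_Suc)
  moreover have "successively (\<lambda>u v. (u, v) \<in> adj G) (map f [0..<Suc n])"
    unfolding successively_conv_nth using f(3) by (auto simp del: upt_Suc)
  moreover have "last (map f [0..<Suc n]) = v" "hd (map f [0..<Suc n]) = u"
    using f(1,2) by (auto simp: hd_map simp del: upt_Suc) (simp_all add: upt_conv_Cons)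
  moreover have "(v, u) \<in> adj G"
    using assms(2) by (simp add: adj_def insert_commute)
  ultimately have "is_cycle G (map f [0..<Suc n])"
    using \<open>2 \<le> n\<close> by (simp add: is_cycle_def del: upt_Suc map_map)
  then show ?thesis ..
qed

locale rooted =
  fixes T :: "'a ugraph" and R :: "'a set"
  assumes rooted: "rooted_tree T R"
begin

abbreviation d :: "'a \<Rightarrow> nat" where
  "d \<equiv> root_dist T R"

lemma simple: "simple_graph T" and connected: "connected_graph T"
  using rooted by (auto simp: rooted_tree_def tree_def)

lemma sym_adj: "sym (adj T)"
  by (auto simp: sym_def adj_def insert_commute)

lemma adjD:
  assumes "(u, v) \<in> adj T"
  shows "u \<in> verts T" "v \<in> verts T" "u \<noteq> v"
  using assms simple by (auto simp: simple_graph_def adj_def doubleton_eq_iff)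

text \<open>The form in which acyclicity is used below.\<close>

lemma bridge:
  assumes "(u, v) \<in> adj T"
  shows "(u, v) \<notin> (adj T - {(u, v), (v, u)})\<^sup>*"
  using cycle_through_edge[OF simple] assms rooted by (auto simp: adj_def rooted_tree_def tree_def)

lemma root_cases:
  obtains (vertex) r where "r \<in> verts T" "R = {r}"
    | (edge) r r' where "R = {r, r'}" "(r, r') \<in> adj T"
proof -
  have "(\<exists>r\<in>verts T. R = {r}) \<or> (\<exists>r r'. R = {r, r'} \<and> (r, r') \<in> adj T)"
    using rooted simple by (auto simp: rooted_tree_def simple_graph_def adj_def)
  then show thesis
    using vertex edge by blast
qed

lemma R_verts: "R \<subseteq> verts T" and finite_R: "finite R" and R_nonempty: "R \<noteq> {}"
  and card_R: "card R \<in> {1, 2}"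
  by (cases rule: root_cases; auto dest: adjD)+

section \<open>Distance from the root\<close>

lemma gdist_le: "(r, v) \<in> adj T ^^ n \<Longrightarrow> gdist T r v \<le> n"
  by (simp add: gdist_def Least_le)

lemma gdist_walk:
  assumes "r \<in> verts T" "v \<in> verts T"
  shows "(r, v) \<in> adj T ^^ gdist T r v"
  unfolding gdist_def using connected assms
  by (metis LeastI connected_graph_def rtrancl_imp_relpow)

lemma root_dist_walk:
  assumes "v \<in> verts T"
  obtains r where "r \<in> R" "(r, v) \<in> adj T ^^ d v"
proof -
  have "d v \<in> (\<lambda>r. gdist T r v) ` R"
    unfolding root_dist_def using finite_R R_nonempty by (intro Min_in) auto
  then show thesis
    using that gdist_walk R_verts assms by auto
qed

lemma root_dist_le:
  assumes "r \<in> R" "(r, v) \<in> adj T ^^ n"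
  shows "d v \<le> n"
proof -
  have "d v \<le> gdist T r v"
    unfolding root_dist_def using finite_R assms by (intro Min_le) auto
  then show ?thesis
    using gdist_le[OF assms(2)] by simp
qed

lemma root_dist_0_iff:
  assumes "v \<in> verts T"
  shows "d v = 0 \<longleftrightarrow> v \<in> R"
proof
  assume "d v = 0"
  then show "v \<in> R"
    using root_dist_walk[OF assms] by (metis relpow_0_E)
next
  assume "v \<in> R"
  then show "d v = 0"
    using root_dist_le[of v v 0] by simp
qed

lemma root_dist_adj:
  assumes "(u, v) \<in> adj T"
  shows "d v \<le> Suc (d u)"
proof -
  obtain r where "r \<in> R" "(r, u) \<in> adj T ^^ d u"
    using root_dist_walk adjD(1)[OF assms] by blast
  then have "(r, v) \<in> adj T ^^ Suc (d u)"
    using assms by auto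
  then show ?thesis
    using root_dist_le \<open>r \<in> R\<close> by blast
qed

lemma parent_exists:
  assumes "v \<in> verts T" "d v = Suc n"
  obtains u where "(u, v) \<in> adj T" "d u = n"
proof -
  obtain r where r: "r \<in> R" "(r, v) \<in> adj T ^^ Suc n"
    using root_dist_walk assms by metis
  then obtain u where u: "(r, u) \<in> adj T ^^ n" "(u, v) \<in> adj T"
    by auto
  then have "d u \<le> n" "Suc n \<le> Suc (d u)"
    using root_dist_le[OF r(1)] root_dist_adj[of u v] assms by auto
  then show thesis
    using that u by auto
qed

text \<open>Repeatedly stepping to a neighbour nearer the root reaches \<open>R\<close>. The bound
  \<open>d x \<le> d v\<close> is recorded so that the path can later be seen to avoid a given
  edge.\<close>

lemma descent:
  assumes "v \<in> verts T"
  shows "\<exists>r\<in>R. (v, r) \<in> {(x, y) \<in> adj T. d x = Suc (d y) \<and> d x \<le> d v}\<^sup>*"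
  using assms
proof (induction "d v" arbitrary: v)
  case 0
  then show ?case
    using root_dist_0_iff by auto
next
  case (Suc n)
  obtain u where u: "(u, v) \<in> adj T" "d u = n"
    using parent_exists Suc.prems Suc.hyps(2) by metis
  then obtain r where r: "r \<in> R" "(u, r) \<in> {(x, y) \<in> adj T. d x = Suc (d y) \<and> d x \<le> d u}\<^sup>*"
    using Suc.hyps(1) adjD(1) by blast
  have "(u, r) \<in> {(x, y) \<in> adj T. d x = Suc (d y) \<and> d x \<le> d v}\<^sup>*"
    using u Suc.hyps(2) by (intro rtrancl_mono[THEN subsetD, OF _ r(2)]) auto
  moreover have "(v, u) \<in> {(x, y) \<in> adj T. d x = Suc (d y) \<and> d x \<le> d v}"
    using u Suc.hyps(2) sym_adj by (auto dest: symD)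
  ultimately show ?case
    using r(1) by (meson converse_rtrancl_into_rtrancl)
qed

text \<open>Paths from \<open>u\<close> and \<open>v\<close> to the root are joined there, through
  the root edge if they end at different roots. In the applications \<open>S\<close> is the
  adjacency without one edge, and the conclusion leads to a contradiction with
  \<open>bridge\<close>.\<close>

lemma connected_via_root:
  assumes "u \<in> verts T" "v \<in> verts T" and S: "sym S" "R \<times> R \<inter> adj T \<subseteq> S"
    and "{(x, y) \<in> adj T. d x = Suc (d y) \<and> d x \<le> d u} \<subseteq> S"
    and "{(x, y) \<in> adj T. d x = Suc (d y) \<and> d x \<le> d v} \<subseteq> S"
  shows "(u, v) \<in> S\<^sup>*"
proof -
  obtain r where r: "r \<in> R" "(u, r) \<in> S\<^sup>*"
    using descent[OF assms(1)] rtrancl_mono[OF assms(5)] by blast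
  obtain r' where r': "r' \<in> R" "(v, r') \<in> S\<^sup>*"
    using descent[OF assms(2)] rtrancl_mono[OF assms(6)] by blast
  have "r = r' \<or> (r, r') \<in> adj T"
    using r(1) r'(1) sym_adj by (cases rule: root_cases) (auto dest: symD)
  then have "(r, r') \<in> S\<^sup>*"
    using S r(1) r'(1) by blast
  moreover have "(r', v) \<in> S\<^sup>*"
    using r'(2) S(1) by (meson sym_rtrancl symD)
  ultimately show ?thesis
    using r(2) by (meson rtrancl_trans)
qed

text \<open>Two parents \<open>p\<close> and \<open>q\<close> are connected through the root by
  steps that avoid the edge \<open>pv\<close>; the edge \<open>qv\<close> then reconnects
  \<open>p\<close> to \<open>v\<close>, although \<open>pv\<close> is a bridge.\<close>

lemma parent_unique:
  assumes p: "(p, v) \<in> adj T" "d v = Suc (d p)" and q: "(q, v) \<in> adj T" "d v = Suc (d q)"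
  shows "p = q"
proof (rule ccontr)
  assume "p \<noteq> q"
  let ?S = "adj T - {(p, v), (v, p)}"
  have "v \<notin> R"
    using p(2) root_dist_0_iff[OF adjD(2)[OF p(1)]] by simp
  have "(p, q) \<in> ?S\<^sup>*"
  proof (rule connected_via_root)
    show "sym ?S"
      using sym_adj unfolding sym_def by blast
    show "p \<in> verts T" "q \<in> verts T"
      using adjD(1)[OF p(1)] adjD(1)[OF q(1)] by simp_all
    show "R \<times> R \<inter> adj T \<subseteq> ?S"
      using \<open>v \<notin> R\<close> by blast
    \<comment> \<open>The step \<open>(v, p)\<close> starts too far from the root, and
      \<open>(p, v)\<close> leads away from it.\<close>
    have *: "{(x, y) \<in> adj T. d x = Suc (d y) \<and> d x \<le> d w} \<subseteq> ?S" if "d v = Suc (d w)" for w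
      using that by auto
    show "{(x, y) \<in> adj T. d x = Suc (d y) \<and> d x \<le> d p} \<subseteq> ?S"
      by (rule *[OF p(2)])
    show "{(x, y) \<in> adj T. d x = Suc (d y) \<and> d x \<le> d q} \<subseteq> ?S"
      by (rule *[OF q(2)])
  qed
  moreover have "(q, v) \<in> ?S"
    using q adjD(3)[OF q(1)] \<open>p \<noteq> q\<close> by auto
  ultimately have "(p, v) \<in> ?S\<^sup>*"
    by (rule rtrancl_into_rtrancl)
  then show False
    using bridge p(1) by blast
qed

text \<open>Steps towards the root change the distance, so they avoid an edge with ends at equal
  distance. Unless it is the root edge, its ends stay connected through the root without it.\<close>

lemma horizontal_edge:
  assumes "(u, v) \<in> adj T" "d u = d v"
  shows "R = {u, v}"
proof (rule ccontr)
  assume "R \<noteq> {u, v}"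
  let ?S = "adj T - {(u, v), (v, u)}"
  have "\<not> (u \<in> R \<and> v \<in> R)"
    using \<open>R \<noteq> {u, v}\<close> adjD(3)[OF assms(1)] by (cases rule: root_cases) auto
  have "(u, v) \<in> ?S\<^sup>*"
  proof (rule connected_via_root)
    show "sym ?S"
      using sym_adj unfolding sym_def by blast
    show "u \<in> verts T" "v \<in> verts T"
      using adjD[OF assms(1)] by simp_all
    show "R \<times> R \<inter> adj T \<subseteq> ?S"
      using \<open>\<not> (u \<in> R \<and> v \<in> R)\<close> by blast
    show "{(x, y) \<in> adj T. d x = Suc (d y) \<and> d x \<le> d u} \<subseteq> ?S"
      "{(x, y) \<in> adj T. d x = Suc (d y) \<and> d x \<le> d v} \<subseteq> ?S"
      using assms(2) by auto
  qed
  then show False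
    using bridge assms(1) by blast
qed

section \<open>The rooted tree as a leveled graph\<close>

definition parent :: "'a \<Rightarrow> 'a" where
  "parent v = (SOME u. (u, v) \<in> adj T \<and> d v = Suc (d u))"

lemma parent:
  assumes "v \<in> verts T" "0 < d v"
  shows "(parent v, v) \<in> adj T" "d v = Suc (d (parent v))"
proof -
  obtain n where n: "d v = Suc n"
    using assms(2) by (cases "d v") auto
  obtain u where "(u, v) \<in> adj T" "d u = n"
    using parent_exists[OF assms(1) n] by blast
  then have "\<exists>u. (u, v) \<in> adj T \<and> d v = Suc (d u)"
    using n by metis
  then have "(parent v, v) \<in> adj T \<and> d v = Suc (d (parent v))"
    unfolding parent_def by (rule someI_ex)
  then show "(parent v, v) \<in> adj T" "d v = Suc (d (parent v))"
    by auto
qed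

lemma parent_eq:
  assumes "(u, v) \<in> adj T" "d v = Suc (d u)"
  shows "parent v = u"
proof (rule parent_unique)
  have "v \<in> verts T" "0 < d v"
    using adjD(2)[OF assms(1)] assms(2) by simp_all
  then show "(parent v, v) \<in> adj T" "d v = Suc (d (parent v))"
    by (rule parent)+
qed (fact assms)+

lemma layer_0: "layer T d 0 = R"
  using root_dist_0_iff R_verts by (auto simp: layer_def)

text \<open>The distances of the ends of an edge differ by at most one. If they are equal, the edge
  is the root edge; otherwise the nearer end is the parent of the other by uniqueness.\<close>

lemma leveled_graph_T: "leveled_graph T d parent"
proof
  show "finite (verts T)"
    using simple by (simp add: simple_graph_def)
  show "card (layer T d 0) \<in> {1, 2}"
    using card_R by (simp add: layer_0)
  show "edges T = (if card (layer T d 0) = 2 then {layer T d 0} else {}) \<union>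
      (\<lambda>v. {parent v, v}) ` {v \<in> verts T. 0 < d v}" (is "_ = ?R \<union> ?P")
    unfolding layer_0
  proof (intro equalityI subsetI)
    fix e assume "e \<in> edges T"
    then obtain u v where e: "e = {u, v}" "(u, v) \<in> adj T" "(v, u) \<in> adj T"
      using simple by (auto simp: simple_graph_def adj_def insert_commute)
    then consider "d u = d v" | "d u = Suc (d v)" | "d v = Suc (d u)"
      using root_dist_adj[of u v] root_dist_adj[of v u] by linarith
    then show "e \<in> (if card R = 2 then {R} else {}) \<union> ?P"
    proof cases
      case 1
      then have "R = {u, v}"
        using horizontal_edge e by blast
      then show ?thesis
        using e adjD(3)[OF e(2)] by auto
    next
      case 2
      then have "e = {parent u, u}" "u \<in> verts T" "0 < d u"
        using 2 parent_eq[of v u] e adjD[OF e(2)] by auto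
      then show ?thesis by blast
    next
      case 3
      then have "e = {parent v, v}" "v \<in> verts T" "0 < d v"
        using 3 parent_eq[of u v] e adjD[OF e(2)] by auto
      then show ?thesis by blast
    qed
  next
    fix e assume "e \<in> (if card R = 2 then {R} else {}) \<union> ?P"
    then consider "card R = 2" "e = R" | "e \<in> ?P"
      by (auto split: if_splits)
    then show "e \<in> edges T"
    proof cases
      case 1
      then show ?thesis
        by (cases rule: root_cases) (auto simp: adj_def)
    next
      case 2
      then show ?thesis
        using parent(1) by (auto simp: adj_def)
    qed
  qed
next
  fix v assume v: "v \<in> verts T" "0 < d v"
  show "parent v \<in> verts T" "d v = Suc (d (parent v))"
    using parent[OF v] adjD(1) by blast+
qed

lemma degree_leveled_graph_T:
  "degree_leveled_graph T d parent (leveled_degree_sequence T R) (num_levels T R - 1)"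
proof -
  interpret leveled_graph T d parent
    by (rule leveled_graph_T)
  \<comment> \<open>\<open>level\<close> counts from 1, whereas \<open>layer\<close> and list
    positions count from 0.\<close>
  have level: "level T R (Suc h) = layer T d h" for h
    by (simp add: level_def layer_def)
  have nth: "leveled_degree_sequence T R ! h =
      rev (sorted_list_of_multiset (image_mset (deg T) (mset_set (layer T d h))))"
    if "h \<le> num_levels T R - 1" for h
    using that by (simp add: leveled_degree_sequence_def num_levels_def level del: upt_Suc)
  show ?thesis
  proof
    show "length (leveled_degree_sequence T R) = Suc (num_levels T R - 1)"
      by (simp add: leveled_degree_sequence_def num_levels_def)
  next
    fix v assume "v \<in> verts T"
    then show "d v \<le> num_levels T R - 1"
      using finite_verts by (simp add: num_levels_def)
  next
    fix h assume "h \<le> num_levels T R - 1"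
    then show "mset (leveled_degree_sequence T R ! h) = image_mset (deg T) (mset_set (layer T d h))"
      and "sorted_wrt (\<ge>) (leveled_degree_sequence T R ! h)"
      by (simp_all add: nth sorted_wrt_rev)
  qed
qed

end

theorem theorem3p16:
  fixes T :: "'a ugraph" and R :: "'a set" and D :: "nat list list"
  assumes "rooted_tree T R"
    and "D = leveled_degree_sequence T R"
  shows "sombor T \<ge> sombor (level_greedy_tree D)"
proof -
  interpret rooted T R
    by unfold_locales (rule assms(1))
  show ?thesis
    unfolding assms(2)
    by (rule degree_leveled_graph.sombor_greedy_le[OF degree_leveled_graph_T])
qed

end
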